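(* Let $P=(X,\leq_P)$ be a connected finite poset with more than one point, let $Q$ be a finite flat poset, and let $f:E(P)\to Q$ be an order homomorphism. If $Q$ does not contain a 4-crown, then there exists an order homomorphism $g:P\to Q$ with $g|_{E(P)}=f$. In particular, if $C\subseteq E(P)$ is a crown with more than four points, then $C$ is a retract of $P$ if and only if $C$ is a retract of $E(P)$.
   Context: Subsets of a poset are identified with induced subposets. $L(P)$, $U(P)$ denote the sets of minimal and maximal points of $P$, and $E(P)=L(P)\cup U(P)$ (as induced subposet). A poset is flat if its height (maximal length of a chain, where a chain with $k$ elements has length $k-1$) is one. A subset $Y$ is a crown if its comparability graph (vertices $Y$, edges between distinct comparable elements) is a cycle; a 4-crown is a crown with 4 points. A retraction of $P$ is an idempotent order homomorphism $r:P\to P$; its image is a retract of $P$. *)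

theory Defs
  imports "HOL-Library.FuncSet"
begin

text \<open>
  A poset is a carrier \<open>X\<close> together with a relation \<open>r\<close> such that \<open>partial_order_on X r\<close>.
  A subset \<open>A\<close> of \<open>X\<close> is identified with the induced subposet, i.e. the carrier \<open>A\<close> with
  the relation \<open>Restr r A\<close>.
\<close>

definition min_points :: "'a set \<Rightarrow> 'a rel \<Rightarrow> 'a set" where
  "min_points X r = {x \<in> X. \<forall>y\<in>X. (y, x) \<in> r \<longrightarrow> y = x}"

definition max_points :: "'a set \<Rightarrow> 'a rel \<Rightarrow> 'a set" where
  "max_points X r = {x \<in> X. \<forall>y\<in>X. (x, y) \<in> r \<longrightarrow> y = x}"

definition extremal_points :: "'a set \<Rightarrow> 'a rel \<Rightarrow> 'a set" where
  "extremal_points X r = min_points X r \<union> max_points X r"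

definition connected_poset :: "'a set \<Rightarrow> 'a rel \<Rightarrow> bool" where
  "connected_poset X r \<longleftrightarrow> (\<forall>x\<in>X. \<forall>y\<in>X. (x, y) \<in> (r \<union> r\<inverse>)\<^sup>*)"

text \<open>
  For a reflexive relation on a finite carrier, \<open>Chains r\<close> is the finite set of all chains
  contained in the carrier. A chain with \<open>k > 0\<close> points has length \<open>k - 1\<close>; the empty chain
  is counted with length \<open>0\<close>, so that the empty poset has height \<open>0\<close>.
\<close>

definition poset_height :: "'a rel \<Rightarrow> nat" where
  "poset_height r = Max ((\<lambda>C. card C - 1) ` Chains r)"

definition flat_poset :: "'a rel \<Rightarrow> bool" where
  "flat_poset r \<longleftrightarrow> poset_height r = 1"

definition order_hom :: "'a set \<Rightarrow> 'a rel \<Rightarrow> 'b set \<Rightarrow> 'b rel \<Rightarrow> ('a \<Rightarrow> 'b) \<Rightarrow> bool" where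
  "order_hom X r Y s f \<longleftrightarrow>
     f \<in> X \<rightarrow> Y \<and> monotone_on X (\<lambda>x y. (x, y) \<in> r) (\<lambda>x y. (x, y) \<in> s) f"

definition comparability_edges :: "'a set \<Rightarrow> 'a rel \<Rightarrow> 'a set set" where
  "comparability_edges Y r = {{x, y} | x y. x \<in> Y \<and> y \<in> Y \<and> x \<noteq> y \<and> (x, y) \<in> r}"

definition cycle_graph :: "'v set \<Rightarrow> 'v set set \<Rightarrow> bool" where
  "cycle_graph V E \<longleftrightarrow>
     (\<exists>n v. n \<ge> 3 \<and> bij_betw v {..<n::nat} V \<and> E = {{v i, v (Suc i mod n)} | i. i < n})"

definition crown :: "'a rel \<Rightarrow> 'a set \<Rightarrow> bool" where
  "crown r Y \<longleftrightarrow> cycle_graph Y (comparability_edges Y r)"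

definition contains_4_crown :: "'a set \<Rightarrow> 'a rel \<Rightarrow> bool" where
  "contains_4_crown X r \<longleftrightarrow> (\<exists>Y\<subseteq>X. crown r Y \<and> card Y = 4)"

definition retraction_on :: "'a set \<Rightarrow> 'a rel \<Rightarrow> ('a \<Rightarrow> 'a) \<Rightarrow> bool" where
  "retraction_on X r h \<longleftrightarrow> order_hom X r X r h \<and> (\<forall>x\<in>X. h (h x) = h x)"

definition retract_of_poset :: "'a set \<Rightarrow> 'a set \<Rightarrow> 'a rel \<Rightarrow> bool" where
  "retract_of_poset C X r \<longleftrightarrow> (\<exists>h. retraction_on X r h \<and> h ` X = C)"

end

theory Submission
  imports Defs
begin

text \<open>
  For a point \<open>x\<close> let \<open>L\<close> and \<open>U\<close> be the sets of minimal points below and of maximal points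
  above \<open>x\<close>. Every element of \<open>f ` L\<close> lies below every element of \<open>f ` U\<close>, so in a flat poset
  without a 4-crown one of the two images is a singleton. Sending a non-extremal \<open>x\<close> to the element of
  \<open>f ` L\<close> if this is a singleton, and otherwise to the element of \<open>f ` U\<close>, is monotone because
  \<open>L\<close> grows and \<open>U\<close> shrinks with \<open>x\<close>. A crown with more than four points consisting of
  extremal points has no 4-crown, so a retraction of \<open>E(P)\<close> onto it extends to \<open>P\<close>.
\<close>

section \<open>Three-point chains and two-by-two bicliques\<close>

definition chain3_free :: "'a rel \<Rightarrow> bool" where
  "chain3_free r \<longleftrightarrow> (\<forall>a b c. (a, b) \<in> r \<longrightarrow> (b, c) \<in> r \<longrightarrow> a = b \<or> b = c)"

text \<open>Equivalently, if A x B is contained in \<open>r\<close>, then A or B has at most one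
  element. Together with reflexivity, this is all that the extension asks of its target.\<close>

definition biclique22_free :: "'a rel \<Rightarrow> bool" where
  "biclique22_free r \<longleftrightarrow>
     (\<forall>a b c d. (a, c) \<in> r \<longrightarrow> (a, d) \<in> r \<longrightarrow> (b, c) \<in> r \<longrightarrow> (b, d) \<in> r \<longrightarrow> a = b \<or> c = d)"

text \<open>If a lower point coincides with an upper one, it sits between the remaining two points,
  and \<open>chain3_free\<close> then gives a = b or c = d. The list follows the cyclic order of the
  4-cycle.\<close>

lemma chain3_free_biclique22_distinct:
  assumes "chain3_free r"
    and "(a, c) \<in> r" "(a, d) \<in> r" "(b, c) \<in> r" "(b, d) \<in> r" "a \<noteq> b" "c \<noteq> d"
  shows "distinct [a, c, b, d]"
  using assms unfolding chain3_free_def by (metis distinct_length_2_or_more distinct_singleton)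

lemma flat_poset_chain3_free:
  assumes "finite Y" "partial_order_on Y s" "flat_poset s"
  shows "chain3_free s"
  unfolding chain3_free_def
proof (intro allI impI, rule ccontr)
  fix a b c assume ab: "(a, b) \<in> s" and bc: "(b, c) \<in> s" and ne: "\<not> (a = b \<or> b = c)"
  note po = partial_order_onD[OF assms(2)]
  have ac: "(a, c) \<in> s" using ab bc po(2) by (meson transD)
  have "a \<noteq> c" using ab bc ne po(3) by (metis antisymD)
  with ne have card: "card {a, b, c} = 3" by simp
  have "{a, b, c} \<in> Chains s"
    using ab bc ac po(1,4) unfolding Chains_def refl_on_def by auto
  moreover have "finite (Chains s)"
    by (rule finite_subset[of _ "Pow Y"]) (use po(4) assms(1) in \<open>auto simp: Chains_def\<close>)
  ultimately have "card {a, b, c} - 1 \<le> poset_height s"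
    unfolding poset_height_def by (intro Max_ge) auto
  with card assms(3) show False by (simp add: flat_poset_def)
qed

text \<open>The middle point of a chain is itself minimal or maximal, hence equal to the point below
  it or to the point above it.\<close>

lemma extremal_chain3_free:
  assumes "partial_order_on X r"
  shows "chain3_free (Restr r (extremal_points X r))"
  using partial_order_onD(4)[OF assms]
  unfolding chain3_free_def extremal_points_def min_points_def max_points_def by blast

section \<open>Four-cycles and crowns\<close>

lemma cycle_graph4:
  assumes "distinct [a, b, c, d]"
  shows "cycle_graph {a, b, c, d} {{a, b}, {b, c}, {c, d}, {d, a}}"
proof -
  let ?v = "\<lambda>i. [a, b, c, d] ! i"
  have 4: "{..<4::nat} = {0, 1, 2, 3}" by auto
  have "bij_betw ?v {..<4} {a, b, c, d}"
    using assms unfolding 4 bij_betw_def inj_on_def by auto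
  moreover have "{{?v i, ?v (Suc i mod 4)} | i. i < 4} = {{a, b}, {b, c}, {c, d}, {d, a}}"
  proof -
    have "{{?v i, ?v (Suc i mod 4)} | i. i < 4} = (\<lambda>i. {?v i, ?v (Suc i mod 4)}) ` {..<4}"
      by blast
    also have "\<dots> = {{a, b}, {b, c}, {c, d}, {d, a}}"
      unfolding 4 by simp
    finally show ?thesis .
  qed
  ultimately show ?thesis unfolding cycle_graph_def by (intro exI[of _ 4] exI[of _ ?v]) simp
qed

text \<open>Distinctness forbids turning back, so the closed walk a, b, c, d runs around the cycle
  in one direction, and returning after four steps forces length 4.\<close>

lemma cycle_graph_4_cycle_card:
  assumes "cycle_graph V E" "distinct [a, b, c, d]"
    and "{a, b} \<in> E" "{b, c} \<in> E" "{c, d} \<in> E" "{d, a} \<in> E"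
  shows "card V = 4"
proof -
  obtain n v where n: "n \<ge> 3" and v: "bij_betw v {..<n::nat} V"
    and E: "E = {{v i, v (Suc i mod n)} | i. i < n}"
    using assms(1) unfolding cycle_graph_def by blast
  \<comment> \<open>The successor modulo n as a case split, so that the final index problem becomes
    linear arithmetic.\<close>
  define S where "S i = (if Suc i = n then 0 else Suc i)" for i
  have S: "Suc i mod n = S i" "S i < n" if "i < n" for i
    using that by (auto simp: S_def)
  have edge: "\<exists>i j. i < n \<and> j < n \<and> x = v i \<and> y = v j \<and> (j = S i \<or> i = S j)" if "{x, y} \<in> E" for x y
    using that S unfolding E by (fastforce simp: doubleton_eq_iff)
  have inj: "v i = v j \<longleftrightarrow> i = j" if "i < n" "j < n" for i j
    using v that by (auto simp: bij_betw_def inj_on_def)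
  obtain i j k l where lt: "i < n" "j < n" "k < n" "l < n"
    and eq: "a = v i" "b = v j" "c = v k" "d = v l"
    using edge[OF assms(3)] edge[OF assms(5)] by blast
  have adj: "q = S p \<or> p = S q" if "{v p, v q} \<in> E" "p < n" "q < n" for p q
    using edge[OF that(1)] that inj by metis
  have "j = S i \<or> i = S j" "k = S j \<or> j = S k" "l = S k \<or> k = S l" "i = S l \<or> l = S i"
    using adj assms(3-6) lt unfolding eq by blast+
  moreover have "i \<noteq> k" "j \<noteq> l" using assms(2) eq by auto
  ultimately have "n = 4" using lt n unfolding S_def by (auto split: if_splits)
  with v show ?thesis by (auto dest: bij_betw_same_card)
qed

lemma biclique22_free_if_no_4_crown:
  assumes "partial_order_on Y s" "chain3_free s" "\<not> contains_4_crown Y s"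
  shows "biclique22_free s"
  unfolding biclique22_free_def
proof (intro allI impI, rule ccontr)
  fix a b c d
  assume r: "(a, c) \<in> s" "(a, d) \<in> s" "(b, c) \<in> s" "(b, d) \<in> s" and "\<not> (a = b \<or> c = d)"
  with assms(2) have dist: "distinct [a, c, b, d]"
    by (intro chain3_free_biclique22_distinct) auto
  have no3: "x = y \<or> y = z" if "(x, y) \<in> s" "(y, z) \<in> s" for x y z
    using assms(2) that unfolding chain3_free_def by blast
  \<comment> \<open>Any of these would form a three-point chain with one of the four given
    relations, so the induced comparability graph is exactly the 4-cycle.\<close>
  have "(a, b) \<notin> s" "(b, a) \<notin> s" "(c, d) \<notin> s" "(d, c) \<notin> s"
    "(c, a) \<notin> s" "(d, a) \<notin> s" "(c, b) \<notin> s" "(d, b) \<notin> s"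
    using no3 r dist by auto
  then have "comparability_edges {a, c, b, d} s = {{a, c}, {c, b}, {b, d}, {d, a}}"
    unfolding comparability_edges_def using r dist by auto
  then have "crown s {a, c, b, d}"
    unfolding crown_def using cycle_graph4[OF dist] by simp
  moreover have "{a, c, b, d} \<subseteq> Y" using r partial_order_onD(4)[OF assms(1)] by auto
  moreover have "card {a, c, b, d} = 4" using dist by simp
  ultimately show False using assms(3) unfolding contains_4_crown_def by blast
qed

text \<open>Lets C itself serve as target of the extension. A violation would be a 4-cycle inside
  the cycle formed by C.\<close>

lemma crown_biclique22_free:
  assumes "chain3_free (Restr r C)" "crown r C" "card C > 4"
  shows "biclique22_free (Restr r C)"
  unfolding biclique22_free_def
proof (intro allI impI, rule ccontr)
  fix a b c d
  assume r: "(a, c) \<in> Restr r C" "(a, d) \<in> Restr r C" "(b, c) \<in> Restr r C" "(b, d) \<in> Restr r C"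
    and "\<not> (a = b \<or> c = d)"
  with assms(1) have dist: "distinct [a, c, b, d]"
    by (intro chain3_free_biclique22_distinct[OF assms(1)]) auto
  have edge: "{x, y} \<in> comparability_edges C r" "{y, x} \<in> comparability_edges C r"
    if "(x, y) \<in> Restr r C" "x \<noteq> y" for x y
    using that unfolding comparability_edges_def by (auto simp: insert_commute)
  have "card C = 4"
    by (rule cycle_graph_4_cycle_card[OF assms(2)[unfolded crown_def] dist])
      (use r dist edge in auto)
  with assms(3) show False by simp
qed

section \<open>Extension from the extremal points\<close>

lemma finite_poset_min_below:
  assumes "finite X" "partial_order_on X r" "x \<in> X"
  shows "\<exists>l \<in> min_points X r. (l, x) \<in> r"
proof -
  note po = partial_order_onD[OF assms(2)]
  have "finite r" using assms(1) po(4) by (meson finite_SigmaI finite_subset)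
  \<comment> \<open>A minimal element of the down-set of x for the strict order is minimal in all of
    X by transitivity.\<close>
  then have "wf (r - Id)" using assms(2) by (rule partial_order_on_well_order_on)
  moreover have "x \<in> {y. (y, x) \<in> r}" using po(1) assms(3) by (auto simp: refl_on_def)
  ultimately obtain l where l: "(l, x) \<in> r" "\<And>y. (y, l) \<in> r - Id \<Longrightarrow> (y, x) \<notin> r"
    by (rule wfE_min) auto
  have "l \<in> min_points X r"
    using l po unfolding min_points_def by (auto dest: transD)
  with l show ?thesis by blast
qed

lemma finite_poset_max_above:
  assumes "finite X" "partial_order_on X r" "x \<in> X"
  shows "\<exists>u \<in> max_points X r. (x, u) \<in> r"
  using finite_poset_min_below[of X "r\<inverse>" x] assms
  by (auto simp: min_points_def max_points_def)

text \<open>Abstracts from flatness and crowns, so that both Q and a crown C can be the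
  target.\<close>

lemma extend_from_extremal_points:
  assumes fin: "finite X" and po: "partial_order_on X r"
    and refl: "refl_on Y s" and free: "biclique22_free s"
    and hom: "order_hom (extremal_points X r) (Restr r (extremal_points X r)) Y s f"
  shows "\<exists>g. order_hom X r Y s g \<and> (\<forall>x\<in>extremal_points X r. g x = f x)"
proof -
  note rX = partial_order_onD(4)[OF po]
  have trans: "(x, z) \<in> r" if "(x, y) \<in> r" "(y, z) \<in> r" for x y z
    using partial_order_onD(2)[OF po] that by (meson transD)
  define E where "E = extremal_points X r"
  define L where "L x = {l \<in> min_points X r. (l, x) \<in> r}" for x
  define U where "U x = {u \<in> max_points X r. (x, u) \<in> r}" for x
  have LU_E: "L x \<subseteq> E" "U x \<subseteq> E" for x
    unfolding L_def U_def E_def extremal_points_def by auto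
  have f_Y: "f x \<in> Y" if "x \<in> E" for x
    using hom that unfolding order_hom_def E_def by auto
  have f_mono: "(f x, f y) \<in> s" if "x \<in> E" "y \<in> E" "(x, y) \<in> r" for x y
    using hom that unfolding order_hom_def E_def monotone_on_def by auto
  have LU: "(f l, f u) \<in> s" if "l \<in> L x" "u \<in> U x" for x l u
    using that LU_E trans by (intro f_mono) (auto simp: L_def U_def)
  \<comment> \<open>Representatives; they enter \<open>g\<close> only where f is constant on the set
    they come from, so the choice is immaterial.\<close>
  define p where "p x = (SOME l. l \<in> L x)" for x
  define q where "q x = (SOME u. u \<in> U x)" for x
  have p: "p x \<in> L x" if "x \<in> X" for x
    using finite_poset_min_below[OF fin po that] unfolding p_def by (auto simp: L_def intro: someI2)
  have q: "q x \<in> U x" if "x \<in> X" for x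
    using finite_poset_max_above[OF fin po that] unfolding q_def by (auto simp: U_def intro: someI2)
  define cL where "cL x \<longleftrightarrow> (\<forall>l\<in>L x. \<forall>l'\<in>L x. f l = f l')" for x
  \<comment> \<open>Two different values on \<open>L x\<close> lie below all values on
    \<open>U x\<close>, so \<open>biclique22_free\<close> leaves only one value there.\<close>
  have cU: "f u = f u'" if "\<not> cL x" "u \<in> U x" "u' \<in> U x" for x u u'
  proof -
    obtain l l' where "l \<in> L x" "l' \<in> L x" "f l \<noteq> f l'" using \<open>\<not> cL x\<close> unfolding cL_def by blast
    with that free show ?thesis unfolding biclique22_free_def using LU by blast
  qed
  \<comment> \<open>Where f is constant on both sets, \<open>L x\<close> always wins: for x below y,
    a value from \<open>U x\<close> at x and one from \<open>L y\<close> at y could come out in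
    reversed order.\<close>
  define g where "g x = (if x \<in> E then f x else if cL x then f (p x) else f (q x))" for x
  have gE: "g x = f x" if "x \<in> E" for x using that by (simp add: g_def)
  have g_L: "g x = f l" if "x \<in> X" "x \<notin> E" "cL x" "l \<in> L x" for x l
    using that p[OF that(1)] unfolding g_def cL_def by metis
  have g_U: "g x = f u" if "x \<in> X" "x \<notin> E" "\<not> cL x" "u \<in> U x" for x u
    using that q[OF that(1)] cU unfolding g_def by metis
  have L_mono: "L x \<subseteq> L y" and U_mono: "U y \<subseteq> U x" if "(x, y) \<in> r" for x y
    using that trans unfolding L_def U_def by auto
  have g_Y: "g x \<in> Y" if "x \<in> X" for x
    using p[OF that] q[OF that] LU_E f_Y unfolding g_def by (simp add: subset_iff)
  have g_refl: "(g x, g x) \<in> s" if "x \<in> X" for x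
    using g_Y[OF that] refl by (auto simp: refl_on_def)
  have "(g x, g y) \<in> s" if xy: "(x, y) \<in> r" for x y
  proof -
    have X: "x \<in> X" "y \<in> X" using xy rX by auto
    \<comment> \<open>If x is in \<open>E\<close> and differs from y, it cannot be maximal, so it is
      minimal and lies in \<open>L y\<close>; dually for y.\<close>
    consider (eq) "x = y" | (min) "x \<in> L y" | (max) "y \<in> U x" | (mid) "x \<notin> E" "y \<notin> E"
      using xy X unfolding L_def U_def E_def extremal_points_def min_points_def max_points_def by blast
    then show ?thesis
    proof cases
      case eq
      then show ?thesis using g_refl X by simp
    next
      case min
      have xE: "x \<in> E" using min LU_E by auto
      show ?thesis
      proof (cases "y \<in> E")
        case True
        then show ?thesis using xE f_mono xy gE by simp
      next
        case False
        show ?thesis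
        proof (cases "cL y")
          case True
          \<comment> \<open>Since x is in \<open>L y\<close>, the common value on \<open>L y\<close>
            is f x itself.\<close>
          then show ?thesis using g_L[OF X(2) False True min] gE[OF xE] g_refl[OF X(1)] by simp
        next
          case nc: False
          then show ?thesis using g_U[OF X(2) False nc q[OF X(2)]] gE[OF xE] LU[OF min q[OF X(2)]] by simp
        qed
      qed
    next
      case max
      have yE: "y \<in> E" using max LU_E by auto
      show ?thesis
      proof (cases "x \<in> E")
        case True
        then show ?thesis using yE f_mono xy gE by simp
      next
        case False
        show ?thesis
        proof (cases "cL x")
          case True
          then show ?thesis using g_L[OF X(1) False True p[OF X(1)]] gE[OF yE] LU[OF p[OF X(1)] max] by simp
        next
          case nc: False
          then show ?thesis using g_U[OF X(1) False nc max] gE[OF yE] g_refl[OF X(2)] by simp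
        qed
      qed
    next
      case mid
      have px: "p x \<in> L x" "p x \<in> L y" and qy: "q y \<in> U y" "q y \<in> U x"
        using p q X L_mono U_mono xy by blast+
      \<comment> \<open>Hence \<open>cL y\<close> without \<open>cL x\<close> cannot occur. The
        remaining cases give f (p x) twice, f (p x) below f (q y), or f (q y) twice.\<close>
      have cL_anti: "cL x" if "cL y" using that L_mono[OF xy] unfolding cL_def by blast
      show ?thesis
      proof (cases "cL y")
        case True
        then have "g x = f (p x)" "g y = f (p x)" using g_L X mid px cL_anti by blast+
        then show ?thesis using g_refl[OF X(1)] by simp
      next
        case False
        then have gy: "g y = f (q y)" using g_U X mid qy by blast
        show ?thesis
        proof (cases "cL x")
          case True
          then have "g x = f (p x)" using g_L X mid px by blast
          then show ?thesis using gy LU[OF px(1) qy(2)] by simp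
        next
          case False
          then have "g x = f (q y)" using g_U X mid qy by blast
          then show ?thesis using gy g_refl[OF X(1)] by simp
        qed
      qed
    qed
  qed
  then have "order_hom X r Y s g"
    using g_Y unfolding order_hom_def monotone_on_def by auto
  with gE show ?thesis unfolding E_def by blast
qed

section \<open>Restricting and extending retractions\<close>

lemma retract_of_poset_mono:
  assumes "C \<subseteq> E" "E \<subseteq> X" "retract_of_poset C X r"
  shows "retract_of_poset C E (Restr r E)"
proof -
  obtain h where h: "order_hom X r X r h" "\<And>x. x \<in> X \<Longrightarrow> h (h x) = h x" "h ` X = C"
    using assms(3) unfolding retract_of_poset_def retraction_on_def by blast
  \<comment> \<open>Idempotence fixes the image C pointwise, so \<open>h\<close> still reaches all
    of C from E.\<close>
  have fix_C: "h c = c" if "c \<in> C" for c using that h(2,3) by auto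
  have "C \<subseteq> h ` E"
  proof
    fix c assume "c \<in> C"
    with fix_C assms(1) show "c \<in> h ` E" by (intro rev_image_eqI[of c]) auto
  qed
  with h(3) assms(2) have "h ` E = C" by blast
  moreover from this have "order_hom E (Restr r E) E (Restr r E) h"
    using h(1) assms(1,2) unfolding order_hom_def monotone_on_def by (auto simp: subset_iff)
  ultimately show ?thesis
    using h(2) assms(2) unfolding retract_of_poset_def retraction_on_def by blast
qed

lemma crown_retract_extends:
  assumes fin: "finite X" and po: "partial_order_on X r"
    and C: "C \<subseteq> extremal_points X r" "crown r C" "card C > 4"
    and retr: "retract_of_poset C (extremal_points X r) (Restr r (extremal_points X r))"
  shows "retract_of_poset C X r"
proof -
  let ?E = "extremal_points X r"
  have EX: "?E \<subseteq> X" unfolding extremal_points_def min_points_def max_points_def by auto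
  obtain h where h: "order_hom ?E (Restr r ?E) ?E (Restr r ?E) h"
      "\<And>x. x \<in> ?E \<Longrightarrow> h (h x) = h x" "h ` ?E = C"
    using retr unfolding retract_of_poset_def retraction_on_def by blast
  have "chain3_free (Restr r C)"
    using extremal_chain3_free[OF po] C(1) unfolding chain3_free_def by blast
  then have free: "biclique22_free (Restr r C)"
    using C(2,3) by (rule crown_biclique22_free)
  have refl: "refl_on C (Restr r C)"
    using partial_order_onD(1)[OF po] C(1) EX unfolding refl_on_def by auto
  \<comment> \<open>The codomain is narrowed to C, which satisfies \<open>biclique22_free\<close>,
    whereas E(P) may contain 4-crowns. The extension then has values in C and fixes C.\<close>
  have "order_hom ?E (Restr r ?E) C (Restr r C) h"
    using h(1,3) unfolding order_hom_def monotone_on_def by auto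
  then obtain g where g: "order_hom X r C (Restr r C) g" "\<And>x. x \<in> ?E \<Longrightarrow> g x = h x"
    using extend_from_extremal_points[OF fin po refl free] by blast
  have fix_C: "g c = c" if "c \<in> C" for c
    using that h(2,3) g(2) C(1) by auto
  have gC: "g x \<in> C" if "x \<in> X" for x
    using g(1) that unfolding order_hom_def by auto
  have "order_hom X r X r g"
    using g(1) C(1) EX unfolding order_hom_def monotone_on_def by auto
  moreover have "g ` X = C"
    using gC fix_C C(1) EX by (auto simp: image_iff subset_iff) metis
  ultimately show ?thesis
    using gC fix_C unfolding retract_of_poset_def retraction_on_def by blast
qed

theorem theorem4:
  fixes X :: "'a set" and r :: "'a rel"
  assumes "finite X" and "partial_order_on X r"
    and "connected_poset X r" and "card X > 1"
  shows "(\<forall>(Y :: 'b set) (s :: 'b rel) f.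
            finite Y \<longrightarrow> partial_order_on Y s \<longrightarrow> flat_poset s \<longrightarrow>
            order_hom (extremal_points X r) (Restr r (extremal_points X r)) Y s f \<longrightarrow>
            \<not> contains_4_crown Y s \<longrightarrow>
            (\<exists>g. order_hom X r Y s g \<and> (\<forall>x\<in>extremal_points X r. g x = f x)))
       \<and> (\<forall>C. C \<subseteq> extremal_points X r \<longrightarrow> crown r C \<longrightarrow> card C > 4 \<longrightarrow>
            (retract_of_poset C X r \<longleftrightarrow>
             retract_of_poset C (extremal_points X r) (Restr r (extremal_points X r))))"
proof (intro conjI allI impI)
  fix Y :: "'b set" and s :: "'b rel" and f
  assume "finite Y" and po: "partial_order_on Y s" and "flat_poset s"
    and hom: "order_hom (extremal_points X r) (Restr r (extremal_points X r)) Y s f"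
    and no4: "\<not> contains_4_crown Y s"
  then have "chain3_free s" by (intro flat_poset_chain3_free)
  with po no4 have "biclique22_free s" by (intro biclique22_free_if_no_4_crown)
  then show "\<exists>g. order_hom X r Y s g \<and> (\<forall>x\<in>extremal_points X r. g x = f x)"
    using extend_from_extremal_points assms(1,2) partial_order_onD(1)[OF po] hom by blast
next
  fix C assume C: "C \<subseteq> extremal_points X r" "crown r C" "card C > 4"
  have "extremal_points X r \<subseteq> X"
    unfolding extremal_points_def min_points_def max_points_def by auto
  then show "retract_of_poset C X r \<longleftrightarrow>
      retract_of_poset C (extremal_points X r) (Restr r (extremal_points X r))"
    using retract_of_poset_mono[OF C(1)] crown_retract_extends[OF assms(1,2) C] by blast
qed

end
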